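(* Let $\mathcal{U}\times\mathcal{V}\subseteq\mathbb{R}^n\times\mathbb{R}^m$ be an open neighborhood of the origin, and let $f:\mathcal{U}\times\mathcal{V}\to\mathbb{R}^n$ be of class $C^1$ with $f(0,0)=0$. Put $A_f:=\frac{\partial f}{\partial x}|_{(0,0)}$ and $B_f:=\frac{\partial f}{\partial u}|_{(0,0)}$. Suppose $\mathrm{cov} f(0,0)>0$ and that $f$ satisfies a type I semitransversality condition at the origin, i.e. there exists an $m\times n$ matrix $Q$ with $A_f=-B_fQ$. Then $\dot x=f(x,u)$ is locally exponentially stabilizable by means of continuously differentiable stationary feedback laws. Moreover, if $Q$ is any $m\times n$ matrix with $A_f=-B_fQ$, this stability is achieved by the linear feedback law $$u(x)=-(QQ^*+I)B_f^*\left(A_fA_f^*+B_fB_f^*\right)^{-1}(I+A_f)x.$$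
   Context: All norms are Euclidean; $\mathbb{B}_r(z)$ is the closed ball of radius $r$ centered at $z$; $A^*$ is the transpose of a real matrix $A$. Linear openness: a mapping $g$ into $\mathbb{R}^n$ defined near $\bar z\in\mathbb{R}^\ell$ is linearly open around $\bar z$ with modulus $\kappa>0$ if there is a neighborhood $\mathcal{W}$ of $\bar z$ such that $\mathbb{B}_{\kappa r}(g(z))\subseteq g(\mathbb{B}_r(z))$ for all $z\in\mathcal{W}$ and $r>0$ with $\mathbb{B}_r(z)\subseteq\mathcal{W}$. $\mathrm{cov}\,g(\bar z)$ denotes the supremum of all such moduli $\kappa$, with $\mathrm{cov}\,g(\bar z):=0$ if $g$ is not linearly open around $\bar z$ for any modulus. The system $\dot x=f(x,u)$ is locally exponentially stabilizable by means of continuously differentiable stationary feedback laws if there exist a $C^1$ feedback $\bar u(x)$ defined near $0\in\mathbb{R}^n$ with $\bar u(0)=0$ and constants $\alpha,M,\delta>0$ such that for every $x_0$ with $\|x_0\|<\delta$ there is a unique solution $\phi(t,x_0)$ of $\dot x=f(x,\bar u(x))$ with $\phi(0,x_0)=x_0$, and $\|\phi(t,x_0)\|\le M\|x_0\|e^{-\alpha t}$ for all $t\ge 0$. *)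

theory Defs
  imports "HOL-Analysis.Analysis"
begin

definition C1_on :: "'a::real_normed_vector set \<Rightarrow> ('a \<Rightarrow> 'b::real_normed_vector) \<Rightarrow> bool" where
  "C1_on S g \<longleftrightarrow>
     (\<exists>g' :: 'a \<Rightarrow> ('a \<Rightarrow>\<^sub>L 'b).
        (\<forall>x\<in>S. (g has_derivative blinfun_apply (g' x)) (at x)) \<and> continuous_on S g')"

text \<open>Functions are total in HOL. Wherever a map is only given on a set, that set \<open>D\<close> is passed
  along explicitly, and the values of the map outside \<open>D\<close> are never used. On pairs, \<open>norm\<close> and
  \<open>cball\<close> are those of the Euclidean norm \<open>sqrt ((norm x)\<^sup>2 + (norm u)\<^sup>2)\<close>.\<close>

definition linearly_open_around ::
  "'a::euclidean_space set \<Rightarrow> ('a \<Rightarrow> 'b::euclidean_space) \<Rightarrow> 'a \<Rightarrow> real \<Rightarrow> bool" where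
  "linearly_open_around D g z0 \<kappa> \<longleftrightarrow>
     \<kappa> > 0 \<and>
     (\<exists>W. W \<subseteq> D \<and> z0 \<in> interior W \<and>
        (\<forall>z\<in>W. \<forall>r>0. cball z r \<subseteq> W \<longrightarrow> cball (g z) (\<kappa> * r) \<subseteq> g ` cball z r))"

text \<open>The supremum is taken in the extended reals, so no boundedness of the set of moduli is
  presupposed. In \<^typ>\<open>ereal\<close> the supremum of the empty set is \<open>-\<infinity>\<close>, hence the case distinction.\<close>

definition cov :: "'a::euclidean_space set \<Rightarrow> ('a \<Rightarrow> 'b::euclidean_space) \<Rightarrow> 'a \<Rightarrow> ereal" where
  "cov D g z0 =
     (if \<exists>\<kappa>. linearly_open_around D g z0 \<kappa>
      then Sup {ereal \<kappa> |\<kappa>. linearly_open_around D g z0 \<kappa>} else 0)"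

definition state_jacobian :: "((real^'n) \<times> (real^'m) \<Rightarrow> real^'n) \<Rightarrow> real^'n^'n" where
  "state_jacobian f = jacobian (\<lambda>x. f (x, 0)) (at 0)"

definition input_jacobian :: "((real^'n) \<times> (real^'m) \<Rightarrow> real^'n) \<Rightarrow> real^'m^'n" where
  "input_jacobian f = jacobian (\<lambda>u. f (0, u)) (at 0)"

definition semitransversal_typeI :: "((real^'n) \<times> (real^'m) \<Rightarrow> real^'n) \<Rightarrow> bool" where
  "semitransversal_typeI f \<longleftrightarrow>
     (\<exists>Q :: real^'n^'m. state_jacobian f = - (input_jacobian f ** Q))"

text \<open>\<open>I\<close> is a time interval with left endpoint \<open>0\<close>; there the derivative is the right-hand one.\<close>

definition ivp_solution ::
  "real set \<Rightarrow> 'a::euclidean_space set \<Rightarrow> ('a \<Rightarrow> 'a) \<Rightarrow> 'a \<Rightarrow> (real \<Rightarrow> 'a) \<Rightarrow> bool" where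
  "ivp_solution I D F x0 \<phi> \<longleftrightarrow>
     \<phi> 0 = x0 \<and>
     (\<forall>t\<in>I. \<phi> t \<in> D \<and> (\<phi> has_vector_derivative F (\<phi> t)) (at t within I))"

text \<open>\<open>N\<close> is the domain of the feedback \<open>u\<close>, so the closed loop is defined at the points
  \<open>x \<in> N\<close> with \<open>(x, u x) \<in> D\<close>. Uniqueness is that of initial value problems: the solution agrees
  with every other solution on any forward interval \<open>[0,T)\<close>; in particular it is the only
  solution on \<open>[0,\<infinity>)\<close>.\<close>

definition exp_stabilizing_feedback ::
  "((real^'n) \<times> (real^'m)) set \<Rightarrow> ((real^'n) \<times> (real^'m) \<Rightarrow> real^'n) \<Rightarrow>
   (real^'n) set \<Rightarrow> (real^'n \<Rightarrow> real^'m) \<Rightarrow> bool" where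
  "exp_stabilizing_feedback D f N u \<longleftrightarrow>
     open N \<and> 0 \<in> N \<and> C1_on N u \<and> u 0 = 0 \<and>
     (\<exists>\<alpha>>0. \<exists>M>0. \<exists>\<delta>>0. \<forall>x0. norm x0 < \<delta> \<longrightarrow>
        (\<exists>\<phi>. ivp_solution {0..} {x\<in>N. (x, u x) \<in> D} (\<lambda>x. f (x, u x)) x0 \<phi> \<and>
             (\<forall>T>0. \<forall>\<psi>. ivp_solution {0..<T} {x\<in>N. (x, u x) \<in> D} (\<lambda>x. f (x, u x)) x0 \<psi>
                \<longrightarrow> (\<forall>t\<in>{0..<T}. \<psi> t = \<phi> t)) \<and>
             (\<forall>t\<ge>0. norm (\<phi> t) \<le> M * norm x0 * exp (- \<alpha> * t))))"

definition locally_exp_stabilizable ::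
  "((real^'n) \<times> (real^'m)) set \<Rightarrow> ((real^'n) \<times> (real^'m) \<Rightarrow> real^'n) \<Rightarrow> bool" where
  "locally_exp_stabilizable D f \<longleftrightarrow> (\<exists>N u. exp_stabilizing_feedback D f N u)"

end

theory Submission
  imports Defs
begin

text \<open>Linear openness forces the derivative \<open>(A B)\<close> of \<open>f\<close> at the origin to be onto, so that
  \<open>S = A A\<^sup>* + B B\<^sup>*\<close> is invertible. Since \<open>A = - B Q\<close>, also \<open>S = B (Q Q\<^sup>* + I) B\<^sup>*\<close>; hence the feedback
  \<open>u(x) = - K x\<close> satisfies \<open>B K = S S\<inverse> (I + A) = I + A\<close>, and the closed loop has linearization
  \<open>A - B K = - I\<close>. As \<open>f\<close> is \<open>C\<^sup>1\<close>, the closed loop is \<open>x' = - x + h(x)\<close> with \<open>h\<close> of Lipschitz constant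
  \<open>L = 1/2\<close> near \<open>0\<close> and \<open>h(0) = 0\<close>. For any two solutions \<open>d = x - y\<close> satisfies
  \<open>(\<bar>d\<bar>\<^sup>2)' \<le> - 2 (1 - L) \<bar>d\<bar>\<^sup>2\<close>, which gives uniqueness, and the decay rate when \<open>y = 0\<close>.\<close>

section \<open>Decay, existence and uniqueness for \<open>x' = - x + h(x)\<close>\<close>

text \<open>The weighted energy \<open>|d|^2 * exp (2 * \<alpha> * s)\<close> has nonpositive
  derivative. Dissipativity is asked only at interior times, so the estimate reaches up to the
  instant at which a solution leaves the region where dissipativity is known.\<close>

lemma norm_decay_if_dissipative:
  fixes d v :: "real \<Rightarrow> 'a::real_inner"
  assumes "0 \<le> t"
    and deriv: "\<And>s. s \<in> {0..t} \<Longrightarrow> (d has_vector_derivative v s) (at s within {0..t})"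
    and diss: "\<And>s. 0 < s \<Longrightarrow> s < t \<Longrightarrow> d s \<bullet> v s \<le> - \<alpha> * (norm (d s))\<^sup>2"
  shows "norm (d t) \<le> norm (d 0) * exp (- \<alpha> * t)"
proof -
  define g where "g s = (d s \<bullet> d s) * exp (2 * \<alpha> * s)" for s
  have cont: "continuous_on {0..t} d"
    using deriv by (rule continuous_on_vector_derivative)
  have "g 0 \<ge> g t"
  proof (rule DERIV_nonpos_imp_decreasing_open[OF \<open>0 \<le> t\<close>])
    show "continuous_on {0..t} g"
      unfolding g_def by (intro continuous_intros cont)
    fix s assume s: "0 < s" "s < t"
    have "(d has_vector_derivative v s) (at s)"
      using deriv[of s] s by (simp add: at_within_Icc_at)
    then have D: "(g has_real_derivative
        (d s \<bullet> v s + v s \<bullet> d s) * exp (2 * \<alpha> * s) + (d s \<bullet> d s) * (exp (2 * \<alpha> * s) * (2 * \<alpha>))) (at s)"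
      unfolding g_def has_vector_derivative_def has_field_derivative_def
      by (auto intro!: derivative_eq_intros simp: algebra_simps)
    have "(d s \<bullet> v s + v s \<bullet> d s) * exp (2 * \<alpha> * s) + (d s \<bullet> d s) * (exp (2 * \<alpha> * s) * (2 * \<alpha>))
        = 2 * exp (2 * \<alpha> * s) * (d s \<bullet> v s + \<alpha> * (norm (d s))\<^sup>2)"
      by (simp add: inner_commute power2_norm_eq_inner algebra_simps)
    also have "\<dots> \<le> 0"
      using diss[OF s] by (intro mult_nonneg_nonpos) auto
    finally show "\<exists>y. (g has_real_derivative y) (at s) \<and> y \<le> 0"
      using D by blast
  qed
  then have "(norm (d t) * exp (\<alpha> * t))\<^sup>2 \<le> (norm (d 0))\<^sup>2"
    by (simp add: g_def power_mult_distrib power2_norm_eq_inner flip: exp_double)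
       (simp add: algebra_simps)
  then have "norm (d t) * exp (\<alpha> * t) \<le> norm (d 0)"
    by (rule power2_le_imp_le) simp
  then show ?thesis
    by (simp add: exp_minus field_simps)
qed

text \<open>Cauchy-Schwarz; this supplies the dissipativity needed above. In use, \<open>x\<close>
  is a solution or a difference of two solutions, and \<open>y\<close> the matching value or
  difference of the perturbation.\<close>

lemma dissipative_perturbation:
  fixes x y :: "'a::real_inner"
  assumes "norm y \<le> L * norm x"
  shows "x \<bullet> (y - x) \<le> - (1 - L) * (norm x)\<^sup>2"
proof -
  have "x \<bullet> y \<le> norm x * norm y"
    by (rule norm_cauchy_schwarz)
  also have "\<dots> \<le> norm x * (L * norm x)"
    using assms by (intro mult_left_mono) auto
  finally show ?thesis
    by (simp add: inner_diff_right power2_norm_eq_inner[symmetric] algebra_simps power2_eq_square)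
qed

text \<open>Banach's fixed point theorem for the variation of constants formula
  \<open>x(t) = e\<^bsup>-t\<^esup> (x0 + \<integral> e\<^sup>s h(x(s)) ds)\<close> over \<open>[0,t]\<close>: since \<open>e\<^bsup>-t\<^esup> \<integral> e\<^sup>s ds \<le> 1\<close>, its right-hand side is an
  \<open>L\<close>-contraction on the bounded continuous functions. These live on all of \<open>real\<close>, so the
  formula is extended constantly to negative times.\<close>

lemma perturbed_decay_solution_exists:
  fixes h :: "'a::euclidean_space \<Rightarrow> 'a"
  assumes lip: "L-lipschitz_on UNIV h" and "L < 1" and "h 0 = 0"
  obtains \<phi> where "\<phi> 0 = x0"
    and "\<And>t. t \<ge> 0 \<Longrightarrow> (\<phi> has_vector_derivative (h (\<phi> t) - \<phi> t)) (at t within {0..})"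
proof -
  have "L \<ge> 0"
    using lip by (rule lipschitz_on_nonneg)
  have h_norm: "norm (h x) \<le> L * norm x" for x
    using lipschitz_onD[OF lip, of x 0] \<open>h 0 = 0\<close> by (simp add: dist_norm)
  have cont_h: "continuous_on S h" for S
    using lipschitz_on_continuous_on[OF lip] continuous_on_subset by blast
  have cont_int: "continuous_on S (\<lambda>s. exp s *\<^sub>R h (apply_bcontfun x s))" for S :: "real set" and x
    by (intro continuous_intros continuous_on_compose2[OF cont_h[of UNIV]]) auto
  define J where "J x t = integral {0..t} (\<lambda>s. exp s *\<^sub>R h (apply_bcontfun x s))"
    for x :: "real \<Rightarrow>\<^sub>C 'a" and t
  have exp_int: "((\<lambda>s. exp s * c) has_integral (exp t - 1) * c) {0..t}" if "t \<ge> 0" for t c :: real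
  proof -
    have "(exp has_integral exp t - exp 0) {0..t}"
      using that by (intro fundamental_theorem_of_calculus)
        (auto intro!: derivative_eq_intros simp flip: has_real_derivative_iff_has_vector_derivative)
    from has_integral_mult_left[OF this, of c] show ?thesis
      by simp
  qed
  \<comment> \<open>Used twice: with the values of \<open>h\<close> along \<open>x\<close> it shows
    that \<open>P x\<close> is bounded, with a difference of such values that \<open>P\<close>
    contracts.\<close>
  have weighted_bound: "exp (- t) * norm (integral {0..t} (\<lambda>s. exp s *\<^sub>R w s)) \<le> c"
    if "t \<ge> 0" "continuous_on {0..t} w" "\<And>s. norm (w s) \<le> c" for t c and w :: "real \<Rightarrow> 'a"
  proof -
    have "c \<ge> 0"
      using that(3)[of 0] norm_ge_zero order_trans by blast
    have "norm (integral {0..t} (\<lambda>s. exp s *\<^sub>R w s)) \<le> integral {0..t} (\<lambda>s. exp s * c)"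
    proof (rule integral_norm_bound_integral)
      show "(\<lambda>s. exp s *\<^sub>R w s) integrable_on {0..t}"
        using that(2) by (intro integrable_continuous_real continuous_intros)
      show "(\<lambda>s. exp s * c) integrable_on {0..t}"
        using exp_int[OF that(1)] by blast
    qed (use that(3) in auto)
    also have "\<dots> = (exp t - 1) * c"
      using exp_int[OF that(1)] by (rule integral_unique)
    finally have "exp (- t) * norm (integral {0..t} (\<lambda>s. exp s *\<^sub>R w s)) \<le> exp (- t) * ((exp t - 1) * c)"
      by (intro mult_left_mono) auto
    also have "\<dots> = (1 - exp (- t)) * c"
      by (simp add: algebra_simps flip: exp_add mult.assoc)
    also have "\<dots> \<le> 1 * c"
      using \<open>c \<ge> 0\<close> by (intro mult_right_mono) auto
    finally show ?thesis by simp
  qed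
  define P where "P x t = exp (- max 0 t) *\<^sub>R (x0 + J x (max 0 t))" for x t
  \<comment> \<open>Indefinite integrals are continuous on compact intervals; near \<open>t\<close>
    the sets \<open>{0..t + 1}\<close> and \<open>{0..}\<close> coincide, which carries this over to
    the half-line.\<close>
  have cont_J: "continuous_on {0..} (J x)" for x
  proof (rule continuous_on_eq_continuous_within[THEN iffD2], rule ballI)
    fix t :: real assume "t \<in> {0..}"
    have "continuous_on {0..t + 1} (J x)"
      unfolding J_def
      by (intro indefinite_integral_continuous_1 integrable_continuous_real cont_int)
    then have "continuous (at t within {0..t + 1}) (J x)"
      using \<open>t \<in> {0..}\<close> by (simp add: continuous_on_eq_continuous_within)
    moreover have "at t within {0..t + 1} = at t within {0..}"
      by (rule at_within_nhd[of _ "{..<t + 1}"]) auto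
    ultimately show "continuous (at t within {0..}) (J x)"
      by simp
  qed
  have "P x \<in> bcontfun" for x
  proof (rule bcontfun_normI)
    show "continuous_on UNIV (P x)"
      unfolding P_def by (intro continuous_intros continuous_on_compose2[OF cont_J]) auto
    show "norm (P x t) \<le> norm x0 + L * norm x" for t
    proof -
      have "norm (h (x s)) \<le> L * norm x" for s
        using h_norm[of "x s"] norm_bounded[of x s] \<open>L \<ge> 0\<close>
        by (meson mult_left_mono order_trans)
      then have "exp (- max 0 t) * norm (J x (max 0 t)) \<le> L * norm x"
        unfolding J_def by (intro weighted_bound continuous_on_compose2[OF cont_h[of UNIV]]) auto
      moreover have "exp (- max 0 t) * norm x0 \<le> 1 * norm x0"
        by (intro mult_right_mono) auto
      moreover have "norm (P x t) \<le> exp (- max 0 t) * (norm x0 + norm (J x (max 0 t)))"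
        unfolding P_def norm_scaleR abs_exp_cancel by (intro mult_left_mono norm_triangle_ineq) auto
      ultimately show ?thesis
        by (simp add: algebra_simps)
    qed
  qed
  then have apply_P: "apply_bcontfun (Bcontfun (P x)) = P x" for x
    by (simp add: Bcontfun_inverse)
  have "dist (Bcontfun (P x)) (Bcontfun (P y)) \<le> L * dist x y" for x y
  proof (rule dist_bound, unfold apply_P)
    fix t :: real
    define \<tau> where "\<tau> = max 0 t"
    have "norm (h (x s) - h (y s)) \<le> L * dist x y" for s
      using lipschitz_onD[OF lip, of "x s" "y s"] mult_left_mono[OF dist_bounded[of x s y] \<open>L \<ge> 0\<close>]
      by (simp add: dist_norm)
    then have "exp (- \<tau>) * norm (integral {0..\<tau>} (\<lambda>s. exp s *\<^sub>R (h (x s) - h (y s)))) \<le> L * dist x y"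
      by (intro weighted_bound continuous_on_diff continuous_on_compose2[OF cont_h[of UNIV]])
         (auto simp: \<tau>_def)
    moreover have "J x \<tau> - J y \<tau> = integral {0..\<tau>} (\<lambda>s. exp s *\<^sub>R (h (x s) - h (y s)))"
      unfolding J_def scaleR_diff_right
      by (intro integral_diff[symmetric] integrable_continuous_real cont_int)
    moreover have "dist (P x t) (P y t) = exp (- \<tau>) * norm (J x \<tau> - J y \<tau>)"
      unfolding P_def \<tau>_def[symmetric] dist_norm scaleR_diff_right[symmetric] norm_scaleR
      by simp
    ultimately show "dist (P x t) (P y t) \<le> L * dist x y"
      by simp
  qed
  then have "\<exists>!x. Bcontfun (P x) = x"
    using \<open>L \<ge> 0\<close> \<open>L < 1\<close> by (intro banach_fix_type) auto
  then obtain x where "Bcontfun (P x) = x"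
    by blast
  then have fixp: "apply_bcontfun x = P x"
    using apply_P[of x] by simp
  show ?thesis
  proof
    show "x 0 = x0"
      unfolding fixp P_def by (simp add: J_def)
    fix t :: real assume "t \<ge> 0"
    have "(J x has_vector_derivative exp t *\<^sub>R h (x t)) (at t within {0..t + 1})"
      unfolding J_def using \<open>t \<ge> 0\<close> by (intro integral_has_vector_derivative cont_int) auto
    moreover have "at t within {0..t + 1} = at t within {0..}"
      by (rule at_within_nhd[of _ "{..<t + 1}"]) auto
    ultimately have DJ: "(J x has_vector_derivative exp t *\<^sub>R h (x t)) (at t within {0..})"
      by simp
    \<comment> \<open>At nonnegative times the truncation by \<open>max\<close> disappears.
      Differentiating this product gives back the equation, since \<open>exp (- t)\<close> and
      \<open>exp t\<close> cancel.\<close>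
    have x_eq: "x s = exp (- s) *\<^sub>R (x0 + J x s)" if "s \<ge> 0" for s
      unfolding fixp P_def using that by (simp add: max_def)
    have "((\<lambda>s. x0 + J x s) has_vector_derivative exp t *\<^sub>R h (x t)) (at t within {0..})"
      using has_vector_derivative_add[OF has_vector_derivative_const DJ] by simp
    moreover have "((\<lambda>s. exp (- s)) has_real_derivative - exp (- t)) (at t within {0..})"
      by (auto intro!: derivative_eq_intros)
    ultimately have "((\<lambda>s. exp (- s) *\<^sub>R (x0 + J x s)) has_vector_derivative
        exp (- t) *\<^sub>R (exp t *\<^sub>R h (x t)) + (- exp (- t)) *\<^sub>R (x0 + J x t)) (at t within {0..})"
      by (intro has_vector_derivative_scaleR)
    also have "exp (- t) *\<^sub>R (exp t *\<^sub>R h (x t)) + (- exp (- t)) *\<^sub>R (x0 + J x t) = h (x t) - x t"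
      using x_eq[OF \<open>t \<ge> 0\<close>] by (simp flip: exp_add)
    finally show "(x has_vector_derivative (h (x t) - x t)) (at t within {0..})"
      using \<open>t \<ge> 0\<close> x_eq by (intro has_vector_derivative_transform[where f = "\<lambda>s. exp (- s) *\<^sub>R (x0 + J x s)" and g = x]) auto
  qed
qed

text \<open>First exit time: before it the solution lies in the ball, where the Lipschitz bound
  makes it decay, so its norm cannot have grown to \<open>r\<close>. Uniqueness needs this for
  arbitrary competing solutions.\<close>

lemma perturbed_decay_stays_in_ball:
  fixes \<psi> :: "real \<Rightarrow> 'a::euclidean_space"
  assumes lip: "L-lipschitz_on (cball 0 r) (\<lambda>x. F x + x)" and "L < 1" and "F 0 = 0"
    and init: "norm (\<psi> 0) < r" and "t \<ge> 0"
    and deriv: "\<And>s. s \<in> {0..t} \<Longrightarrow> (\<psi> has_vector_derivative F (\<psi> s)) (at s within {0..t})"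
  shows "norm (\<psi> t) < r"
proof (rule ccontr)
  assume "\<not> norm (\<psi> t) < r"
  \<comment> \<open>The times spent outside the open ball form a compact set, so there is a least
    one, \<open>T\<close>.\<close>
  define X where "X = {s \<in> {0..t}. r \<le> norm (\<psi> s)}"
  have "continuous_on {0..t} \<psi>"
    using deriv by (rule continuous_on_vector_derivative)
  then have "closed X"
    unfolding X_def by (intro continuous_on_closed_Collect_le continuous_intros) auto
  moreover have "X \<subseteq> {0..t}" "t \<in> X"
    using \<open>\<not> norm (\<psi> t) < r\<close> \<open>t \<ge> 0\<close> by (auto simp: X_def)
  ultimately have "compact X"
    using compact_Icc compact_Int_closed by (metis inf.absorb_iff2)
  then obtain T where T: "T \<in> X" "\<And>s. s \<in> X \<Longrightarrow> T \<le> s"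
    using compact_attains_inf[of X] \<open>t \<in> X\<close> by blast
  then have T': "0 \<le> T" "T \<le> t" "r \<le> norm (\<psi> T)"
    by (auto simp: X_def)
  have "norm (\<psi> T) \<le> norm (\<psi> 0) * exp (- (1 - L) * T)"
  proof (rule norm_decay_if_dissipative[OF \<open>0 \<le> T\<close>])
    show "(\<psi> has_vector_derivative F (\<psi> s)) (at s within {0..T})" if "s \<in> {0..T}" for s
      using deriv[of s] that T' by (auto intro: has_vector_derivative_within_subset)
    fix s assume "0 < s" "s < T"
    then have "\<psi> s \<in> cball 0 r"
      using T(2)[of s] T'(2) by (force simp: X_def)
    moreover have "0 \<in> cball (0::'a) r"
      using norm_ge_zero[of "\<psi> 0"] init by (simp del: norm_ge_zero)
    ultimately have "norm (F (\<psi> s) + \<psi> s) \<le> L * norm (\<psi> s)"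
      using lipschitz_onD[OF lip, of "\<psi> s" 0] \<open>F 0 = 0\<close> by (simp add: dist_norm)
    from dissipative_perturbation[OF this]
    show "\<psi> s \<bullet> F (\<psi> s) \<le> - (1 - L) * (norm (\<psi> s))\<^sup>2"
      by simp
  qed
  also have "\<dots> \<le> norm (\<psi> 0) * 1"
    using \<open>L < 1\<close> \<open>0 \<le> T\<close> by (intro mult_left_mono) (auto intro: mult_nonpos_nonneg)
  finally show False
    using T'(3) init by simp
qed

text \<open>Uniqueness comes from the decay estimate for the difference of two solutions, which
  starts at \<open>0\<close>. The norm itself serves as Lyapunov function, so the decay bound has
  factor 1.\<close>

lemma perturbed_decay_exp_stable:
  fixes F :: "'a::euclidean_space \<Rightarrow> 'a"
  assumes lip: "L-lipschitz_on (cball 0 r) (\<lambda>x. F x + x)" and "L < 1" and "F 0 = 0"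
    and D: "cball 0 r \<subseteq> D" and x0: "norm x0 < r"
  shows "\<exists>\<phi>. ivp_solution {0..} D F x0 \<phi> \<and>
      (\<forall>T>0. \<forall>\<psi>. ivp_solution {0..<T} D F x0 \<psi> \<longrightarrow> (\<forall>t\<in>{0..<T}. \<psi> t = \<phi> t)) \<and>
      (\<forall>t\<ge>0. norm (\<phi> t) \<le> norm x0 * exp (- (1 - L) * t))"
proof -
  have "r > 0"
    using x0 norm_ge_zero[of x0] by linarith
  \<comment> \<open>Projecting onto the ball extends the perturbation to a globally Lipschitz one; by the decay
    estimate the solution of the extended equation never leaves the ball.\<close>
  define p where "p = closest_point (cball (0::'a) r)"
  have p: "dist (p x) (p y) \<le> dist x y" "p x \<in> cball 0 r" for x y
    unfolding p_def using \<open>r > 0\<close> by (intro closest_point_lipschitz closest_point_in_set; simp)+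
  have p_self: "p x = x" if "x \<in> cball 0 r" for x
    unfolding p_def using that by (rule closest_point_self)
  define h where "h x = F (p x) + p x" for x
  have "L \<ge> 0"
    using lip by (rule lipschitz_on_nonneg)
  have lip_h: "L-lipschitz_on UNIV h"
  proof (rule lipschitz_onI[OF _ \<open>L \<ge> 0\<close>])
    fix x y
    have "dist (h x) (h y) \<le> L * dist (p x) (p y)"
      unfolding h_def using lipschitz_onD[OF lip p(2) p(2)] .
    also have "\<dots> \<le> L * dist x y"
      using p(1) \<open>L \<ge> 0\<close> by (intro mult_left_mono)
    finally show "dist (h x) (h y) \<le> L * dist x y" .
  qed
  have "h 0 = 0"
    using \<open>r > 0\<close> \<open>F 0 = 0\<close> by (simp add: h_def p_self)
  obtain \<phi> where \<phi>0: "\<phi> 0 = x0"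
    and \<phi>: "\<And>t. t \<ge> 0 \<Longrightarrow> (\<phi> has_vector_derivative (h (\<phi> t) - \<phi> t)) (at t within {0..})"
    using perturbed_decay_solution_exists[OF lip_h \<open>L < 1\<close> \<open>h 0 = 0\<close>] by blast
  \<comment> \<open>For the extended equation the Lipschitz bound holds everywhere, so the estimate
    does not presuppose that \<open>\<phi>\<close> stays in the ball.\<close>
  have decay: "norm (\<phi> t) \<le> norm x0 * exp (- (1 - L) * t)" if "t \<ge> 0" for t
    unfolding \<phi>0[symmetric]
  proof (rule norm_decay_if_dissipative[OF that])
    show "(\<phi> has_vector_derivative (h (\<phi> s) - \<phi> s)) (at s within {0..t})" if "s \<in> {0..t}" for s
      using that by (intro has_vector_derivative_within_subset[OF \<phi>]) auto
    show "\<phi> s \<bullet> (h (\<phi> s) - \<phi> s) \<le> - (1 - L) * (norm (\<phi> s))\<^sup>2" for s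
      using lipschitz_onD[OF lip_h, of "\<phi> s" 0] \<open>h 0 = 0\<close>
      by (intro dissipative_perturbation) (simp add: dist_norm)
  qed
  have in_ball: "\<phi> t \<in> cball 0 r" if "t \<ge> 0" for t
  proof -
    have "norm x0 * exp (- (1 - L) * t) \<le> norm x0 * 1"
      using \<open>L < 1\<close> that by (intro mult_left_mono) (auto intro: mult_nonpos_nonneg)
    then show ?thesis
      using decay[OF that] x0 by simp
  qed
  have \<phi>': "(\<phi> has_vector_derivative F (\<phi> t)) (at t within {0..})" if "t \<ge> 0" for t
    using \<phi>[OF that] p_self[OF in_ball[OF that]] by (simp add: h_def)
  have unique: "\<psi> t = \<phi> t"
    if \<psi>: "ivp_solution {0..<T} D F x0 \<psi>" and t: "t \<in> {0..<T}" for T \<psi> t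
  proof -
    \<comment> \<open>\<open>\<psi>\<close> is given only on \<open>[0,T)\<close>, while the
      estimates work on compact intervals \<open>[0,b]\<close> with \<open>b < T\<close>.\<close>
    have \<psi>': "(\<psi> has_vector_derivative F (\<psi> s)) (at s within {0..b})" if "s \<in> {0..b}" "b < T" for s b
      using \<psi> that unfolding ivp_solution_def
      by (intro has_vector_derivative_within_subset[where S = "{0..<T}" and T = "{0..b}"]) auto
    have \<psi>0: "\<psi> 0 = x0"
      using \<psi> by (simp add: ivp_solution_def)
    have \<psi>_ball: "\<psi> s \<in> cball 0 r" if "0 \<le> s" "s < T" for s
      using perturbed_decay_stays_in_ball[OF lip \<open>L < 1\<close> \<open>F 0 = 0\<close> _ \<open>0 \<le> s\<close> \<psi>'] \<psi>0 x0 that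
      by fastforce
    have "norm (\<psi> t - \<phi> t) \<le> norm (\<psi> 0 - \<phi> 0) * exp (- (1 - L) * t)"
    proof (rule norm_decay_if_dissipative)
      show "0 \<le> t"
        using t by simp
      show "((\<lambda>s. \<psi> s - \<phi> s) has_vector_derivative F (\<psi> s) - F (\<phi> s)) (at s within {0..t})"
        if "s \<in> {0..t}" for s
        using that t by (intro has_vector_derivative_diff \<psi>' has_vector_derivative_within_subset[OF \<phi>']) auto
      fix s assume s: "0 < s" "s < t"
      have "norm ((F (\<psi> s) + \<psi> s) - (F (\<phi> s) + \<phi> s)) \<le> L * norm (\<psi> s - \<phi> s)"
        using lipschitz_onD[OF lip \<psi>_ball in_ball, of s s] s t by (simp add: dist_norm)
      from dissipative_perturbation[OF this]
      show "(\<psi> s - \<phi> s) \<bullet> (F (\<psi> s) - F (\<phi> s)) \<le> - (1 - L) * (norm (\<psi> s - \<phi> s))\<^sup>2"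
        by (simp add: algebra_simps)
    qed
    then show ?thesis
      by (simp add: \<phi>0 \<psi>0)
  qed
  have "ivp_solution {0..} D F x0 \<phi>"
    using \<phi>0 \<phi>' in_ball D by (auto simp: ivp_solution_def simp del: mem_cball)
  with unique decay show ?thesis
    by blast
qed

section \<open>Linearization and linear openness\<close>

text \<open>Mean value inequality for \<open>g - g0\<close>: its derivative at \<open>z\<close> is
  \<open>g' z - g' a\<close>, which is small near \<open>a\<close> by continuity of
  \<open>g'\<close>.\<close>

lemma C1_on_lipschitz_remainder:
  fixes g :: "'a::real_normed_vector \<Rightarrow> 'b::real_normed_vector"
  assumes "C1_on S g" "open S" "a \<in> S" "(g has_derivative g0) (at a)" "\<epsilon> > 0"
  obtains r where "r > 0" "cball a r \<subseteq> S" "\<epsilon>-lipschitz_on (cball a r) (\<lambda>x. g x - g0 x)"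
proof -
  obtain g' :: "'a \<Rightarrow> 'a \<Rightarrow>\<^sub>L 'b"
    where g': "\<And>x. x \<in> S \<Longrightarrow> (g has_derivative g' x) (at x)" and cont: "continuous_on S g'"
    using assms(1) unfolding C1_on_def by blast
  have g0: "g0 = g' a"
    using has_derivative_unique[OF assms(4) g'[OF \<open>a \<in> S\<close>]] .
  have "\<forall>\<^sub>F x in nhds a. dist (g' x) (g' a) < \<epsilon> \<and> x \<in> S"
  proof (rule eventually_conj)
    have "isCont g' a"
      using cont \<open>open S\<close> \<open>a \<in> S\<close> by (simp add: continuous_on_eq_continuous_at)
    then show "\<forall>\<^sub>F x in nhds a. dist (g' x) (g' a) < \<epsilon>"
      using \<open>\<epsilon> > 0\<close> by (simp add: isCont_def tendsto_at_iff_tendsto_nhds tendstoD)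
    show "\<forall>\<^sub>F x in nhds a. x \<in> S"
      using \<open>open S\<close> \<open>a \<in> S\<close> by (rule eventually_nhds_in_open)
  qed
  then obtain e where e: "e > 0" "\<And>x. dist x a < e \<Longrightarrow> dist (g' x) (g' a) < \<epsilon> \<and> x \<in> S"
    unfolding eventually_nhds_metric by blast
  have sub: "x \<in> cball a (e / 2) \<Longrightarrow> dist x a < e" for x
    using \<open>e > 0\<close> by (simp add: dist_commute)
  show ?thesis
  proof
    show "e / 2 > 0"
      using \<open>e > 0\<close> by simp
    show "cball a (e / 2) \<subseteq> S"
      using e(2) sub by blast
    show "\<epsilon>-lipschitz_on (cball a (e / 2)) (\<lambda>x. g x - g0 x)"
    proof (rule lipschitz_onI)
      fix x y assume xy: "x \<in> cball a (e / 2)" "y \<in> cball a (e / 2)"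
      have "norm ((g x - g0 x) - (g y - g0 y)) \<le> \<epsilon> * norm (x - y)"
      proof (rule differentiable_bound[OF convex_cball _ _ xy(1) xy(2)])
        fix z assume "z \<in> cball a (e / 2)"
        then have z: "dist (g' z) (g' a) < \<epsilon>" "z \<in> S"
          using e(2) sub by blast+
        show "((\<lambda>x. g x - g0 x) has_derivative (g' z - g' a)) (at z within cball a (e / 2))"
          unfolding g0 minus_blinfun.rep_eq fun_diff_def
          by (intro has_derivative_diff has_derivative_at_withinI[OF g'[OF z(2)]]
              bounded_linear_imp_has_derivative blinfun.bounded_linear_right)
        show "onorm (g' z - g' a) \<le> \<epsilon>"
          using z(1) by (simp add: dist_norm norm_blinfun.rep_eq)
      qed
      then show "dist (g x - g0 x) (g y - g0 y) \<le> \<epsilon> * dist x y"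
        by (simp add: dist_norm)
    qed (use \<open>\<epsilon> > 0\<close> in simp)
  qed
qed

text \<open>If \<open>y\<close> were nonzero and orthogonal to the range of \<open>g0\<close>, then along \<open>y\<close> the image of a ball of
  radius \<open>r\<close> would only have size \<open>o(r)\<close>.\<close>

lemma linearly_open_derivative_range:
  fixes g :: "'a::euclidean_space \<Rightarrow> 'b::euclidean_space"
  assumes "linearly_open_around D g a \<kappa>" and deriv: "(g has_derivative g0) (at a)"
    and orth: "\<And>z. y \<bullet> g0 z = 0"
  shows "y = 0"
proof (rule ccontr)
  assume "y \<noteq> 0"
  obtain W where "\<kappa> > 0" "a \<in> interior W"
    and W: "\<And>z r. z \<in> W \<Longrightarrow> r > 0 \<Longrightarrow> cball z r \<subseteq> W \<Longrightarrow> cball (g z) (\<kappa> * r) \<subseteq> g ` cball z r"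
    using assms(1) unfolding linearly_open_around_def by blast
  obtain e where e: "e > 0" "cball a e \<subseteq> W"
    using \<open>a \<in> interior W\<close> unfolding mem_interior_cball by blast
  \<comment> \<open>The slope is half the modulus, so the remainder is too small to account for a
    displacement of length \<open>\<kappa> * r\<close>.\<close>
  obtain d where d: "d > 0"
    "\<And>x. norm (x - a) < d \<Longrightarrow> norm (g x - g a - g0 (x - a)) \<le> \<kappa> / 2 * norm (x - a)"
    using deriv \<open>\<kappa> > 0\<close> unfolding has_derivative_at_alt by (meson half_gt_zero)
  define r where "r = min e (d / 2)"
  have r: "r > 0" "r \<le> e" "r < d"
    using e(1) d(1) by (auto simp: r_def)
  have "cball a r \<subseteq> W"
    using e(2) r(2) by auto
  have "g a + (\<kappa> * r) *\<^sub>R sgn y \<in> cball (g a) (\<kappa> * r)"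
    using \<open>y \<noteq> 0\<close> \<open>\<kappa> > 0\<close> r(1) by (simp add: dist_norm norm_sgn)
  also have "\<dots> \<subseteq> g ` cball a r"
    using \<open>cball a r \<subseteq> W\<close> r(1) by (intro W) auto
  finally obtain z where z: "norm (z - a) \<le> r" "g z = g a + (\<kappa> * r) *\<^sub>R sgn y"
    by (metis (no_types, lifting) dist_norm imageE mem_cball norm_minus_commute)
  \<comment> \<open>Pairing with \<open>y\<close> removes \<open>g0 (z - a)\<close>, so the
    remainder alone must produce the whole displacement; the next bound allows only half of
    it.\<close>
  have "y \<bullet> (g z - g a - g0 (z - a)) = \<kappa> * r * norm y"
    using \<open>y \<noteq> 0\<close>
    by (simp add: z(2) inner_diff_right orth sgn_div_norm dot_square_norm power2_eq_square)
  moreover have "y \<bullet> (g z - g a - g0 (z - a)) \<le> norm y * (\<kappa> / 2 * r)"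
  proof -
    have "norm (g z - g a - g0 (z - a)) \<le> \<kappa> / 2 * norm (z - a)"
      using z(1) r(3) by (intro d(2)) simp
    also have "\<dots> \<le> \<kappa> / 2 * r"
      using z(1) \<open>\<kappa> > 0\<close> by (intro mult_left_mono) auto
    finally have "norm y * norm (g z - g a - g0 (z - a)) \<le> norm y * (\<kappa> / 2 * r)"
      by (intro mult_left_mono) auto
    then show ?thesis
      using norm_cauchy_schwarz order_trans by blast
  qed
  ultimately show False
    using \<open>y \<noteq> 0\<close> \<open>\<kappa> > 0\<close> r(1) by (simp add: field_simps)
qed

section \<open>Matrix algebra and linear feedbacks\<close>

text \<open>Pairing the image of \<open>y\<close> with \<open>y\<close> gives
  \<open>|A^* y|^2 + |B^* y|^2\<close>, so a kernel vector is orthogonal to the ranges of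
  \<open>A\<close> and \<open>B\<close>.\<close>

lemma invertible_gram_sum:
  fixes A :: "real^'k^'n" and B :: "real^'m^'n"
  assumes "\<And>y. (\<And>a b. y \<bullet> (A *v a + B *v b) = 0) \<Longrightarrow> y = 0"
  shows "invertible (A ** transpose A + B ** transpose B)"
proof -
  have "y = 0" if "(A ** transpose A + B ** transpose B) *v y = 0" for y
  proof (rule assms)
    fix a b
    have "y \<bullet> ((A ** transpose A + B ** transpose B) *v y) =
        (transpose A *v y) \<bullet> (transpose A *v y) + (transpose B *v y) \<bullet> (transpose B *v y)"
      by (simp add: matrix_vector_mult_add_rdistrib inner_add_right
          flip: matrix_vector_mul_assoc dot_lmul_matrix)
    then have "transpose A *v y = 0" "transpose B *v y = 0"
      using that by (simp_all add: add_nonneg_eq_0_iff)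
    then show "y \<bullet> (A *v a + B *v b) = 0"
      by (simp add: inner_add_right flip: dot_lmul_matrix)
  qed
  then show ?thesis
    unfolding invertible_left_inverse matrix_left_invertible_ker by blast
qed

lemma matrix_inv_right_if_invertible:
  fixes A :: "'a::semiring_1^'n^'m"
  assumes "invertible A"
  shows "A ** matrix_inv A = mat 1"
  using someI_ex[OF assms[unfolded invertible_def]] unfolding matrix_inv_def by blast

lemma matrix_add_mult_distrib_right:
  fixes A B :: "'a::semiring_1^'n^'m" and C :: "'a^'k^'n"
  shows "(A + B) ** C = A ** C + B ** C"
  by (simp add: matrix_matrix_mult_def vec_eq_iff distrib_right sum.distrib)

lemma C1_on_linear:
  fixes u :: "'a::euclidean_space \<Rightarrow> 'b::real_normed_vector"
  assumes "linear u"
  shows "C1_on S u"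
proof -
  have "bounded_linear u"
    using assms by (simp add: linear_conv_bounded_linear)
  then show ?thesis
    unfolding C1_on_def
    by (intro exI[of _ "\<lambda>_. Blinfun u"])
       (auto simp: bounded_linear_Blinfun_apply intro: bounded_linear_imp_has_derivative)
qed

section \<open>The closed loop\<close>

theorem theorem22:
  fixes U :: "(real^'n) set" and V :: "(real^'m) set"
    and f :: "(real^'n) \<times> (real^'m) \<Rightarrow> real^'n"
    and A :: "real^'n^'n" and B :: "real^'m^'n"
  defines "A \<equiv> state_jacobian f" and "B \<equiv> input_jacobian f"
  assumes "open (U \<times> V)" and "(0, 0) \<in> U \<times> V"
    and "C1_on (U \<times> V) f" and "f (0, 0) = 0"
    and "cov (U \<times> V) f (0, 0) > 0"
    and "semitransversal_typeI f"
  shows "locally_exp_stabilizable (U \<times> V) f \<and>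
    (\<forall>Q :: real^'n^'m. A = - (B ** Q) \<longrightarrow>
       invertible (A ** transpose A + B ** transpose B) \<and>
       exp_stabilizing_feedback (U \<times> V) f UNIV
         (\<lambda>x. - (((Q ** transpose Q + mat 1) ** transpose B
                   ** matrix_inv (A ** transpose A + B ** transpose B)
                   ** (mat 1 + A)) *v x)))"
proof -
  obtain f0 where f0: "(f has_derivative f0) (at (0, 0))"
    using \<open>C1_on (U \<times> V) f\<close> \<open>(0, 0) \<in> U \<times> V\<close> unfolding C1_on_def by blast
  then have "linear f0"
    by (rule has_derivative_linear)
  \<comment> \<open>The chain rule along the two coordinate embeddings identifies \<open>A\<close>
    and \<open>B\<close> with the blocks of \<open>f0\<close>.\<close>
  have "((\<lambda>x. f (x, 0)) has_derivative (\<lambda>a. f0 (a, 0))) (at 0)"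
    by (rule has_derivative_compose[of "\<lambda>x. (x, 0)" "\<lambda>a. (a, 0)", OF _ f0])
       (auto intro!: derivative_eq_intros)
  then have A: "A *v a = f0 (a, 0)" for a
    unfolding A_def state_jacobian_def jacobian_def
    by (metis frechet_derivative_at has_derivative_linear matrix_works linear_matrix_vector_mul_eq)
  have "((\<lambda>u. f (0, u)) has_derivative (\<lambda>b. f0 (0, b))) (at 0)"
    by (rule has_derivative_compose[of "\<lambda>u. (0, u)" "\<lambda>b. (0, b)", OF _ f0])
       (auto intro!: derivative_eq_intros)
  then have B: "B *v b = f0 (0, b)" for b
    unfolding B_def input_jacobian_def jacobian_def
    by (metis frechet_derivative_at has_derivative_linear matrix_works linear_matrix_vector_mul_eq)
  have f0_eq: "f0 (a, b) = A *v a + B *v b" for a b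
    unfolding A B by (simp flip: linear_add[OF \<open>linear f0\<close>])
  \<comment> \<open>Positivity of \<open>cov\<close> rules out its default value \<open>0\<close>,
    so some modulus exists.\<close>
  obtain \<kappa> where "linearly_open_around (U \<times> V) f (0, 0) \<kappa>"
    using \<open>cov (U \<times> V) f (0, 0) > 0\<close> unfolding cov_def by (auto split: if_splits)
  from linearly_open_derivative_range[OF this f0]
  have "y = 0" if "\<And>a b. y \<bullet> (A *v a + B *v b) = 0" for y
    using that by (simp add: f0_eq split_paired_all)
  then have inv: "invertible (A ** transpose A + B ** transpose B)"
    by (rule invertible_gram_sum)

  have stab: "exp_stabilizing_feedback (U \<times> V) f UNIV
         (\<lambda>x. - (((Q ** transpose Q + mat 1) ** transpose B
                   ** matrix_inv (A ** transpose A + B ** transpose B)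
                   ** (mat 1 + A)) *v x))"
    if Q: "A = - (B ** Q)" for Q :: "real^'n^'m"
  proof -
    define S where "S = A ** transpose A + B ** transpose B"
    define K where "K = (Q ** transpose Q + mat 1) ** transpose B ** matrix_inv S ** (mat 1 + A)"
    define u where "u x = - (K *v x)" for x
    have "linear u"
      unfolding u_def by (intro linear_compose_neg matrix_vector_mul_linear)
    have "transpose A = - (transpose Q ** transpose B)"
      unfolding Q by (simp add: transpose_def vec_eq_iff matrix_matrix_mult_def mult.commute)
    moreover have minus_mult_minus: "(- X) ** (- Y) = X ** Y" for X :: "real^'n^'n" and Y :: "real^'n^'n"
      by (simp add: matrix_matrix_mult_def vec_eq_iff)
    ultimately have "A ** transpose A = B ** (Q ** transpose Q) ** transpose B"
      using minus_mult_minus[of "B ** Q" "transpose Q ** transpose B"] Q by (simp add: matrix_mul_assoc)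
    then have "S = B ** ((Q ** transpose Q + mat 1) ** transpose B)"
      by (simp add: S_def matrix_add_ldistrib matrix_add_mult_distrib_right matrix_mul_assoc)
    then have "B ** K = S ** matrix_inv S ** (mat 1 + A)"
      by (simp add: K_def matrix_mul_assoc)
    also have "\<dots> = mat 1 + A"
      using inv by (simp add: S_def matrix_inv_right_if_invertible)
    finally have BK: "f0 (x, u x) = - x" for x
      by (simp add: f0_eq u_def linear_neg[OF matrix_vector_mul_linear] matrix_vector_mul_assoc
          matrix_vector_mult_add_rdistrib)
    \<comment> \<open>By linearity \<open>c\<close> is also a Lipschitz constant of the graph map of
      \<open>u\<close>. The tolerance \<open>1 / (2 * c)\<close> below compensates for it and yields
      1/2; the radius \<open>r / c\<close> keeps the graph in the ball.\<close>
    obtain c where "c > 0" and c: "\<And>x. norm (x, u x) \<le> c * norm x"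
    proof -
      have "bounded_linear (\<lambda>x. (x, u x))"
        using \<open>linear u\<close> by (intro bounded_linear_Pair bounded_linear_ident) (simp add: linear_conv_bounded_linear)
      from bounded_linear.pos_bounded[OF this] show ?thesis
        using that by (auto simp: mult.commute)
    qed
    obtain r where "r > 0" and r: "cball (0, 0) r \<subseteq> U \<times> V"
      and lip: "(1 / (2 * c))-lipschitz_on (cball (0, 0) r) (\<lambda>z. f z - f0 z)"
      using C1_on_lipschitz_remainder[OF \<open>C1_on (U \<times> V) f\<close> \<open>open (U \<times> V)\<close> \<open>(0, 0) \<in> U \<times> V\<close> f0, of "1 / (2 * c)"]
        \<open>c > 0\<close> by auto
    have graph: "(x, u x) \<in> cball (0, 0) r" if "x \<in> cball 0 (r / c)" for x
    proof -
      have "c * norm x \<le> r"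
        using that \<open>c > 0\<close> by (simp add: field_simps)
      with c[of x] show ?thesis
        by (simp flip: zero_prod_def)
    qed
    have "(1 / 2)-lipschitz_on (cball 0 (r / c)) (\<lambda>x. f (x, u x) + x)"
    proof (rule lipschitz_onI)
      fix x y :: "real^'n" assume xy: "x \<in> cball 0 (r / c)" "y \<in> cball 0 (r / c)"
      \<comment> \<open>By \<open>BK\<close>, \<open>f (x, u x) + x\<close> is the remainder
        \<open>f - f0\<close> evaluated on the graph.\<close>
      have "dist (f (x, u x) + x) (f (y, u y) + y) \<le> 1 / (2 * c) * dist (x, u x) (y, u y)"
        using lipschitz_onD[OF lip graph[OF xy(1)] graph[OF xy(2)]] by (simp add: BK)
      also have "\<dots> \<le> 1 / (2 * c) * (c * dist x y)"
        using c[of "x - y"] \<open>c > 0\<close> linear_diff[OF \<open>linear u\<close>, of x y]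
        by (intro mult_left_mono) (auto simp: dist_norm)
      finally show "dist (f (x, u x) + x) (f (y, u y) + y) \<le> 1 / 2 * dist x y"
        using \<open>c > 0\<close> by simp
    qed simp
    moreover have "u 0 = 0"
      using \<open>linear u\<close> by (rule linear_0)
    moreover have "cball 0 (r / c) \<subseteq> {x \<in> UNIV. (x, u x) \<in> U \<times> V}"
      using graph r by blast
    \<comment> \<open>The rate is \<open>1 - L = 1 / 2\<close>; the explicit factor \<open>1\<close>
      is the witness for \<open>M\<close>.\<close>
    ultimately have "\<exists>\<phi>. ivp_solution {0..} {x \<in> UNIV. (x, u x) \<in> U \<times> V} (\<lambda>x. f (x, u x)) x0 \<phi> \<and>
        (\<forall>T>0. \<forall>\<psi>. ivp_solution {0..<T} {x \<in> UNIV. (x, u x) \<in> U \<times> V} (\<lambda>x. f (x, u x)) x0 \<psi> \<longrightarrow>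
          (\<forall>t\<in>{0..<T}. \<psi> t = \<phi> t)) \<and>
        (\<forall>t\<ge>0. norm (\<phi> t) \<le> 1 * norm x0 * exp (- (1 / 2) * t))" if "norm x0 < r / c" for x0
      using perturbed_decay_exp_stable[of "1 / 2" "r / c" "\<lambda>x. f (x, u x)" _ x0] \<open>f (0, 0) = 0\<close> that
      by simp
    moreover have "r / c > 0"
      using \<open>r > 0\<close> \<open>c > 0\<close> by simp
    ultimately have "exp_stabilizing_feedback (U \<times> V) f UNIV u"
      unfolding exp_stabilizing_feedback_def using \<open>u 0 = 0\<close> C1_on_linear[OF \<open>linear u\<close>]
      by (intro conjI exI[of _ "1 / 2 :: real"] exI[of _ "1 :: real"] exI[of _ "r / c"]) simp_all
    then show ?thesis
      unfolding u_def K_def S_def .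
  qed
  moreover have "locally_exp_stabilizable (U \<times> V) f"
    using \<open>semitransversal_typeI f\<close> stab
    unfolding semitransversal_typeI_def locally_exp_stabilizable_def A_def B_def by blast
  ultimately show ?thesis
    using inv by blast
qed

end
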